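(* Let $s,t$ be positive integers, and let $p_1,\dots,p_r$ ($r\ge 0$) be the primes dividing both $s$ and $t$, listed in any chosen order. Let $\Psi=\Psi_{s,t;(p_1,\dots,p_r)}$ be the map on $s$-regular, $t$-distinct partitions defined in the context. Then, for every $n\ge 0$, $\Psi$ is a bijection from the set of partitions of $n$ that are simultaneously $s$-regular and $t$-distinct onto the set of partitions of $n$ that are simultaneously $t$-regular and $s$-distinct.
   Context: A partition of $n$ is a nonincreasing finite sequence of positive integers (parts) with sum $n$; equivalently a finitely supported assignment of a frequency (number of appearances) to each positive integer. A partition is $m$-regular if no part is divisible by $m$, and $m$-distinct if every part size appears fewer than $m$ times. The union of partitions is the partition whose frequencies are the sums of the frequencies. Glaisher's map $\phi_m$ ($m\ge 2$), extended to all partitions: given a partition $\lambda$, for each $j\ge 1$ with $m\nmid j$ and each $k\ge 0$, write the frequency of the part $jm^k$ in base $m$ as $\sum_{i\ge 0} a^{(j)}_{k,i}m^i$ with $0\le a^{(j)}_{k,i}<m$. Then $\phi_m(\lambda)$ is the partition in which, for each such $j$ and each $i\ge 0$, the part $jm^i$ has frequency $\sum_{k\ge 0} a^{(j)}_{k,i}m^k$ (that is, the matrices $(a^{(j)}_{k,i})_{k,i}$ are transposed). By convention $\phi_1$ is the identity (below it is only ever applied to the empty partition). Compositions are read right to left: $\phi_a\phi_b(\lambda)=\phi_a(\phi_b(\lambda))$. Write $s=s'\,p_1^{e_1}\cdots p_r^{e_r}$ where all $e_i\ge 1$ and $s'$ is coprime to $t$ (so $s'$ is the product of the full prime powers in $s$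 of the primes dividing $s$ but not $t$). For $1\le i\le r$ write $t=p_i^{b_i}k_i$ with $b_i\geq 1$ and $p_i\nmid k_i$. Put $W_i=s'p_1^{e_1}\cdots p_{i-1}^{e_{i-1}}$ for $1\le i\le r$ (so $W_1=s'$). Definition of $\Psi(\lambda)$ for $\lambda$ $s$-regular and $t$-distinct: Stage 0. Let $\lambda^{(0)}$ be the partition formed by the parts of $\lambda$ (with their frequencies) not divisible by $s'$. Set $\mu^{(0)}=\phi_{s'}\phi_t(\lambda^{(0)})$. Stage $i$, for $1\le i\le r$. Take the parts of $\lambda$ that are divisible by $W_i$ but not by $W_ip_i^{e_i}$, and divide each of these part sizes by $W_i$, keeping frequencies; call the resulting partition $\rho^{(i)}$ (it is $p_i^{e_i}$-regular and $t$-distinct). For each part size $x$ of $\rho^{(i)}$, write its frequency as $a_x+C_xk_i$ with $0\le a_x<k_i$ and $0\le C_x<p_i^{b_i}$. Let $\alpha^{(i)}$ be the partition in which each $x$ appears $a_x$ times, and let $\beta^{(i)}$ be the partition in which, for each $x$, the part $xk_i$ appears $C_x$ times. Let $\nu^{(i)}$ be the union of $\phi_{p_i^{e_i}}\phi_{k_i}(\alpha^{(i)})$ and $\phi_{p_i}(\beta^{(i)})$. Let $\mu^{(i)}$ be obtained from $\nu^{(i)}$ by multiplying the frequency of every part size by $W_i$. Finally $\Psi(\lambda)$ is the union of $\mu^{(0)},\mu^{(1)},\dots,\mu^{(r)}$. *)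

theory Defs
  imports "HOL-Computational_Algebra.Primes" "HOL-Library.Multiset"
begin

text \<open>Partitions are multisets of positive integers: \<^term>\<open>count \<Lambda> x\<close> is the frequency of
  the part \<^term>\<open>x\<close>, and the union of partitions is the multiset sum \<^term>\<open>(+)\<close>.\<close>

definition partition_of :: "nat \<Rightarrow> nat multiset \<Rightarrow> bool" where
  "partition_of n \<Lambda> \<longleftrightarrow> (\<forall>x\<in>#\<Lambda>. 0 < x) \<and> sum_mset \<Lambda> = n"

definition regular :: "nat \<Rightarrow> nat multiset \<Rightarrow> bool" where
  "regular m \<Lambda> \<longleftrightarrow> (\<forall>x\<in>#\<Lambda>. \<not> m dvd x)"

definition m_distinct :: "nat \<Rightarrow> nat multiset \<Rightarrow> bool" where
  "m_distinct m \<Lambda> \<longleftrightarrow> (\<forall>x\<in>#\<Lambda>. count \<Lambda> x < m)"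

definition digit :: "nat \<Rightarrow> nat \<Rightarrow> nat \<Rightarrow> nat" where
  "digit m i f = (f div m ^ i) mod m"

text \<open>Every \<^term>\<open>y > 0\<close> is uniquely \<^term>\<open>j * m ^ i\<close> with \<^term>\<open>\<not> m dvd j\<close>. The base need not be
  prime; then \<^term>\<open>multiplicity m y\<close> is still the largest exponent \<^term>\<open>i\<close> with
  \<^term>\<open>m ^ i dvd y\<close>. The sum over all \<^term>\<open>k\<close> is restricted to its finitely many possibly nonzero
  terms. For \<^term>\<open>m < 2\<close> the map is the identity by convention; in \<open>Psi\<close> it is then only applied to the
  empty partition.\<close>

definition glaisher_freq :: "nat \<Rightarrow> nat multiset \<Rightarrow> nat \<Rightarrow> nat" where
  "glaisher_freq m \<Lambda> y =
    (if y = 0 then 0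
     else let i = multiplicity m y; j = y div m ^ i
          in \<Sum>k | j * m ^ k \<in># \<Lambda>. digit m i (count \<Lambda> (j * m ^ k)) * m ^ k)"

definition glaisher :: "nat \<Rightarrow> nat multiset \<Rightarrow> nat multiset" where
  "glaisher m \<Lambda> = (if m < 2 then \<Lambda> else Abs_multiset (glaisher_freq m \<Lambda>))"

lemma finite_glaisher_freq:
  assumes "2 \<le> m"
  shows "finite {y. 0 < glaisher_freq m \<Lambda> y}"
proof (rule finite_subset)
  let ?A = "(\<lambda>(j, i). j * m ^ i) ` ({..Max (set_mset \<Lambda>)} \<times> {..size \<Lambda>})"
  show "finite ?A" by simp
  show "{y. 0 < glaisher_freq m \<Lambda> y} \<subseteq> ?A"
  proof
    fix y assume "y \<in> {y. 0 < glaisher_freq m \<Lambda> y}"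
    then have pos: "0 < glaisher_freq m \<Lambda> y" by simp
    define i where "i = multiplicity m y"
    define j where "j = y div m ^ i"
    have y0: "y \<noteq> 0" using pos by (cases "y = 0") (simp_all add: glaisher_freq_def)
    have "(\<Sum>k | j * m ^ k \<in># \<Lambda>. digit m i (count \<Lambda> (j * m ^ k)) * m ^ k) \<noteq> 0"
      using pos y0 by (simp add: glaisher_freq_def i_def j_def Let_def)
    then obtain k where k: "j * m ^ k \<in># \<Lambda>" "digit m i (count \<Lambda> (j * m ^ k)) \<noteq> 0"
      by (metis (no_types, lifting) mem_Collect_eq mult_is_0 sum.neutral)
    have yj: "y = j * m ^ i"
      by (simp add: j_def i_def multiplicity_dvd)
    have "j * m ^ k \<le> Max (set_mset \<Lambda>)" using k(1) by simp
    moreover have "j \<le> j * m ^ k" using assms by simp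
    ultimately have "j \<le> Max (set_mset \<Lambda>)" by linarith
    moreover have "m ^ i \<le> count \<Lambda> (j * m ^ k)"
      using k(2) by (metis digit_def div_less linorder_not_le mod_0)
    then have "i \<le> size \<Lambda>"
      using less_exp[of i] power_mono[of 2 m i] assms count_le_size[of \<Lambda> "j * m ^ k"]
      by linarith
    ultimately show "y \<in> ?A" using yj by auto
  qed
qed

lemma count_glaisher:
  assumes "2 \<le> m" "\<not> m dvd j"
  shows "count (glaisher m \<Lambda>) (j * m ^ i) =
    (\<Sum>k | j * m ^ k \<in># \<Lambda>. digit m i (count \<Lambda> (j * m ^ k)) * m ^ k)"
proof -
  have "j \<noteq> 0" using assms(2) by (metis dvd_0_right)
  have "multiplicity m (j * m ^ i) = i"
    using assms by (intro multiplicity_eqI) auto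
  then show ?thesis
    using assms \<open>j \<noteq> 0\<close> finite_glaisher_freq[OF assms(1), of \<Lambda>]
    by (simp add: glaisher_def glaisher_freq_def Abs_multiset_inverse)
qed

lemma count_glaisher_0: "2 \<le> m \<Longrightarrow> count (glaisher m \<Lambda>) 0 = 0"
  using finite_glaisher_freq[of m \<Lambda>] by (simp add: glaisher_def glaisher_freq_def)

definition coprime_part :: "nat \<Rightarrow> nat \<Rightarrow> nat" where
  "coprime_part s t = (\<Prod>p | prime p \<and> p dvd s \<and> \<not> p dvd t. p ^ multiplicity p s)"

text \<open>The common primes are given by a list \<^term>\<open>ps\<close> and indexed from 0, so \<open>weight s t ps i\<close>
  is the product of \<open>s'\<close> and the full prime powers of the first \<^term>\<open>i\<close> primes, and
  \<open>stage s t ps i\<close> below treats the prime \<^term>\<open>ps ! i\<close>.\<close>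

definition weight :: "nat \<Rightarrow> nat \<Rightarrow> nat list \<Rightarrow> nat \<Rightarrow> nat" where
  "weight s t ps i = coprime_part s t * (\<Prod>j<i. (ps ! j) ^ multiplicity (ps ! j) s)"

definition residue_part :: "nat \<Rightarrow> nat multiset \<Rightarrow> nat multiset" where
  "residue_part k \<rho> = (\<Sum>x\<in>set_mset \<rho>. replicate_mset (count \<rho> x mod k) x)"

definition quotient_part :: "nat \<Rightarrow> nat multiset \<Rightarrow> nat multiset" where
  "quotient_part k \<rho> = (\<Sum>x\<in>set_mset \<rho>. replicate_mset (count \<rho> x div k) (x * k))"

definition stage0 :: "nat \<Rightarrow> nat \<Rightarrow> nat multiset \<Rightarrow> nat multiset" where
  "stage0 s t \<Lambda> =
    (let s' = coprime_part s t
     in glaisher s' (glaisher t {#x \<in># \<Lambda>. \<not> s' dvd x#}))"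

definition stage :: "nat \<Rightarrow> nat \<Rightarrow> nat list \<Rightarrow> nat \<Rightarrow> nat multiset \<Rightarrow> nat multiset" where
  "stage s t ps i \<Lambda> =
    (let p = ps ! i;
         e = multiplicity p s;
         k = t div p ^ multiplicity p t;
         W = weight s t ps i;
         \<rho> = image_mset (\<lambda>x. x div W) {#x \<in># \<Lambda>. W dvd x \<and> \<not> W * p ^ e dvd x#};
         \<alpha> = residue_part k \<rho>;
         \<beta> = quotient_part k \<rho>;
         \<nu> = glaisher (p ^ e) (glaisher k \<alpha>) + glaisher p \<beta>
     in repeat_mset W \<nu>)"

definition Psi :: "nat \<Rightarrow> nat \<Rightarrow> nat list \<Rightarrow> nat multiset \<Rightarrow> nat multiset" where
  "Psi s t ps \<Lambda> = stage0 s t \<Lambda> + (\<Sum>i<length ps. stage s t ps i \<Lambda>)"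

end

theory Submission
  imports Defs
begin

text \<open>Glaisher's map transposes digit matrices, so it is an involution that preserves sums, exchanges
  being regular for \<open>m ^ e\<close> with being distinct for \<open>m ^ e\<close>, and \<open>\<phi>\<^sub>a \<phi>\<^sub>b\<close> exchanges \<open>a\<close> and \<open>b\<close> when these are
  coprime. There are two dual ways to pass from factors to a product: a partition that is regular for \<open>k q\<close>
  splits into its parts not divisible by \<open>k\<close> and \<open>k\<close> times a partition regular for \<open>q\<close>; a partition that is
  distinct for \<open>k q\<close> splits into its frequencies mod \<open>k\<close> and \<open>k\<close> copies of a partition distinct for \<open>q\<close>. Splitting
  in one way, applying bijections to both components and recombining in the other way is again a bijection.
  Within a stage this is done for \<open>t = k p ^ b\<close>, splitting frequencies and joining parts (\<open>\<phi>\<^sub>p\<close> commutes with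
  multiplying all parts by \<open>k\<close>, as \<open>k\<close> is coprime to \<open>p\<close>); across the stages it is done for
  the weights \<open>W\<^sub>i p\<^sub>i ^ e\<^sub>i\<close>, splitting parts and joining frequencies.\<close>

section \<open>Glaisher's map\<close>

lemma digit_less: "0 < m \<Longrightarrow> digit m i f < m"
  by (simp add: digit_def)

lemma digit_eq_0: "f < m ^ i \<Longrightarrow> digit m i f = 0"
  by (simp add: digit_def)

lemma sum_digits_less:
  fixes a :: "nat \<Rightarrow> nat"
  assumes "\<And>k. a k < m"
  shows "(\<Sum>k<N. a k * m ^ k) < m ^ N"
proof (induction N)
  case (Suc N)
  have "(\<Sum>k<Suc N. a k * m ^ k) < m ^ N + a N * m ^ N"
    using Suc by simp
  also have "\<dots> = Suc (a N) * m ^ N" by simp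
  also have "\<dots> \<le> m * m ^ N"
    using assms[of N] by (intro mult_le_mono1) simp
  finally show ?case by simp
qed simp

text \<open>Uniqueness of digits. The value 0 beyond \<open>N\<close> lets a truncated sum stand for
  a whole row of the digit matrix.\<close>

lemma digit_sum:
  assumes "\<And>k. a k < m"
  shows "digit m i (\<Sum>k<N. a k * m ^ k) = (if i < N then a i else 0)"
  using assms
proof (induction i arbitrary: N a)
  case 0
  then show ?case
  proof (cases N)
    case (Suc M)
    \<comment> \<open>Modulo \<open>m\<close> only the term \<open>a 0\<close> survives.\<close>
    have "m dvd (\<Sum>k<M. a (Suc k) * m ^ Suc k)" by (intro dvd_sum) simp
    with Suc 0 show ?thesis
      by (simp add: digit_def sum.lessThan_Suc_shift del: sum.lessThan_Suc power_Suc)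
         (metis mod_add_right_eq add.right_neutral dvd_imp_mod_0 mod_less)
  qed (simp add: digit_def)
next
  case (Suc i)
  have m: "0 < m" using Suc.prems[of 0] by simp
  \<comment> \<open>Dividing by \<open>m\<close> shifts the expansion by one place; the induction
    hypothesis is then used for the shifted digits, one fewer in number.\<close>
  have step: "digit m (Suc i) f = digit m i (f div m)" for f
    by (simp add: digit_def div_mult2_eq)
  show ?case
  proof (cases N)
    case 0
    then show ?thesis by (simp add: digit_def)
  next
    case (Suc M)
    have "(\<Sum>k<N. a k * m ^ k) = a 0 + m * (\<Sum>k<M. a (Suc k) * m ^ k)"
      unfolding Suc sum.lessThan_Suc_shift by (simp add: sum_distrib_left mult_ac)
    then have "(\<Sum>k<N. a k * m ^ k) div m = (\<Sum>k<M. a (Suc k) * m ^ k)"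
      using m Suc.prems[of 0] by simp
    then show ?thesis
      using Suc.IH[of "\<lambda>k. a (Suc k)" M] Suc.prems by (simp add: step Suc)
  qed
qed

lemma sum_digit:
  assumes "f < m ^ N"
  shows "(\<Sum>k<N. digit m k f * m ^ k) = f"
proof -
  \<comment> \<open>Truncated expansions are residues; this form can be proved by induction.\<close>
  have "(\<Sum>k<M. digit m k f * m ^ k) = f mod m ^ M" for M
  proof (induction M)
    case (Suc M)
    then show ?case
      unfolding power_Suc2 mod_mult2_eq by (simp add: digit_def)
  qed simp
  with assms show ?thesis by simp
qed

section \<open>Chains \<open>j * m ^ k\<close> and the digit matrix\<close>

lemma multiplicity_times_power:
  fixes m :: nat
  assumes "2 \<le> m" "\<not> m dvd j"
  shows "multiplicity m (j * m ^ i) = i"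
  using assms by (intro multiplicity_eqI) auto

lemma core_decomposition:
  fixes m :: nat
  assumes "2 \<le> m" "0 < y"
  obtains j i where "y = j * m ^ i" "\<not> m dvd j"
  using multiplicity_decompose'[of y m] assms by (metis mult.commute nat_dvd_1_iff_1 not_gr_zero numeral_le_one_iff semiring_norm(69))

text \<open>Extending the index set of \<open>count_glaisher\<close> to an initial segment adds only
  absent parts, whose digits are 0. The sum becomes a base \<open>m\<close> expansion to which the
  digit lemmas apply.\<close>

lemma count_glaisher_lessThan:
  assumes "2 \<le> m" "\<not> m dvd j" "\<And>k. N \<le> k \<Longrightarrow> count \<Lambda> (j * m ^ k) = 0"
  shows "count (glaisher m \<Lambda>) (j * m ^ i) = (\<Sum>k<N. digit m i (count \<Lambda> (j * m ^ k)) * m ^ k)"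
  unfolding count_glaisher[OF assms(1,2)]
proof (rule sum.mono_neutral_left)
  show "{k. j * m ^ k \<in># \<Lambda>} \<subseteq> {..<N}"
    using assms(3) by (metis (mono_tags, lifting) lessThan_iff mem_Collect_eq not_in_iff not_less subsetI)
  show "\<forall>k\<in>{..<N} - {k. j * m ^ k \<in># \<Lambda>}. digit m i (count \<Lambda> (j * m ^ k)) * m ^ k = 0"
    by (auto simp: not_in_iff digit_def)
qed simp

lemma zero_notin_glaisher: "2 \<le> m \<Longrightarrow> 0 \<notin># glaisher m \<Lambda>"
  by (simp add: not_in_iff count_glaisher_0)

lemma in_glaisher_core:
  assumes "2 \<le> m" "y \<in># glaisher m \<Lambda>"
  obtains j i k where "y = j * m ^ i" "\<not> m dvd j" "j * m ^ k \<in># \<Lambda>"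
proof -
  have "0 < y" using assms zero_notin_glaisher by (metis gr0I)
  then obtain j i where ji: "y = j * m ^ i" "\<not> m dvd j"
    using core_decomposition[OF assms(1)] by blast
  have "\<exists>k. j * m ^ k \<in># \<Lambda>"
  proof (rule ccontr)
    assume "\<nexists>k. j * m ^ k \<in># \<Lambda>"
    then have "count (glaisher m \<Lambda>) y = 0"
      using assms(1) ji by (simp add: count_glaisher)
    with assms(2) show False by (metis not_in_iff)
  qed
  with ji that show ?thesis by blast
qed

text \<open>Only the chain positions \<open>k < e\<close> can be occupied, so each frequency of the
  image has at most \<open>e\<close> digits.\<close>

lemma glaisher_less_power:
  assumes "2 \<le> m" "\<And>x. x \<in># \<Lambda> \<Longrightarrow> \<not> m ^ e dvd x"
  shows "count (glaisher m \<Lambda>) y < m ^ e"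
proof (cases "y = 0")
  case False
  then obtain j i where ji: "y = j * m ^ i" "\<not> m dvd j"
    using core_decomposition[OF assms(1)] by blast
  have "count \<Lambda> (j * m ^ k) = 0" if "e \<le> k" for k
    using assms(2) that by (meson dvd_mult le_imp_power_dvd not_in_iff)
  then show ?thesis
    using assms(1) ji by (simp add: count_glaisher_lessThan[where N = e] sum_digits_less digit_less)
qed (use assms count_glaisher_0 in simp)

text \<open>Dual to \<open>glaisher_less_power\<close>: frequencies below \<open>m ^ b\<close> have
  no digit at position \<open>b\<close> or later, so the image has no part there in a chain.\<close>

lemma glaisher_not_power_dvd:
  assumes "2 \<le> m" "\<And>x. count \<Lambda> x < m ^ b" "y \<in># glaisher m \<Lambda>"
  shows "\<not> m ^ b dvd y"
proof
  assume dvd: "m ^ b dvd y"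
  obtain j i k where ji: "y = j * m ^ i" "\<not> m dvd j" "j * m ^ k \<in># \<Lambda>"
    using in_glaisher_core[OF assms(1,3)] by blast
  \<comment> \<open>The base may be composite, so this is shown by cancelling \<open>m ^ i\<close>:
    otherwise \<open>m\<close> would divide \<open>j\<close>.\<close>
  have "b \<le> i"
  proof (rule ccontr)
    assume "\<not> b \<le> i"
    then have "m ^ i * m dvd m ^ b"
      by (metis le_imp_power_dvd not_less_eq_eq power_Suc2)
    with dvd ji(1) have "m ^ i * m dvd m ^ i * j"
      by (metis dvd_trans mult.commute)
    with ji(2) assms(1) show False by simp
  qed
  then have "count \<Lambda> x < m ^ i" for x
    using assms(1,2) power_increasing[of b i m] by (meson le_trans less_le_trans one_le_numeral)
  then have "count (glaisher m \<Lambda>) y = 0"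
    using assms(1) ji by (simp add: count_glaisher digit_eq_0)
  with assms(3) show False by (metis not_in_iff)
qed

lemma member_le_sum_mset: "x \<in># M \<Longrightarrow> x \<le> sum_mset M" for x :: nat
  by (metis le_add1 sum_mset.remove)

lemma multiset_bound:
  fixes \<Lambda> :: "nat multiset"
  obtains N where "\<And>x. x \<in># \<Lambda> \<Longrightarrow> x < N" "\<And>x. count \<Lambda> x < N"
proof
  show "x < Suc (sum_mset \<Lambda> + size \<Lambda>)" if "x \<in># \<Lambda>" for x
    using member_le_sum_mset[OF that] by simp
  show "count \<Lambda> x < Suc (sum_mset \<Lambda> + size \<Lambda>)" for x
    using count_le_size[of \<Lambda> x] by simp
qed

text \<open>Through this a bound on the parts also bounds the exponents that occur in a
  chain.\<close>

lemma less_times_power: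
  fixes m :: nat
  assumes "2 \<le> m" "\<not> m dvd j"
  shows "k < j * m ^ k"
proof -
  have "k < m ^ k" using assms(1) by (simp add: power_gt_expt)
  also have "\<dots> \<le> j * m ^ k" using assms(2) by (cases j) auto
  finally show ?thesis .
qed

lemma count_times_power_eq_0:
  assumes "2 \<le> m" "\<not> m dvd j" "\<And>x. x \<in># M \<Longrightarrow> x < N" "N \<le> k"
  shows "count M (j * m ^ k) = 0"
  using less_times_power[OF assms(1,2), of k] assms(3)[of "j * m ^ k"] assms(4)
  by (meson not_in_iff not_less order_less_le_trans order_less_imp_le)

text \<open>This is the transposition: the frequency of \<open>j * m ^ i\<close> in the image is by
  construction an expansion with known digits, and digits are unique.\<close>

lemma digit_count_glaisher:
  assumes "2 \<le> m" "\<not> m dvd j"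
  shows "digit m k (count (glaisher m \<Lambda>) (j * m ^ i)) = digit m i (count \<Lambda> (j * m ^ k))"
proof -
  obtain N where N: "\<And>x. x \<in># \<Lambda> \<Longrightarrow> x < N"
    using multiset_bound by metis
  have zero: "count \<Lambda> (j * m ^ k) = 0" if "N \<le> k" for k
    using count_times_power_eq_0[OF assms N that] .
  show ?thesis
    using assms zero[of k] by (simp add: count_glaisher_lessThan[OF assms zero] digit_sum digit_less)
       (simp add: digit_def)
qed

lemma glaisher_involution:
  assumes "2 \<le> m" "0 \<notin># \<Lambda>"
  shows "glaisher m (glaisher m \<Lambda>) = \<Lambda>"
proof (rule multiset_eqI)
  fix y
  show "count (glaisher m (glaisher m \<Lambda>)) y = count \<Lambda> y"
  proof (cases "y = 0")
    case True
    with assms show ?thesis by (simp add: count_glaisher_0 not_in_iff)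
  next
    case False
    then obtain j i where ji: "y = j * m ^ i" "\<not> m dvd j"
      using core_decomposition[OF assms(1)] by blast
    obtain N where N: "\<And>x. x \<in># glaisher m \<Lambda> \<Longrightarrow> x < N"
      using multiset_bound by metis
    obtain N' where N': "\<And>x. count \<Lambda> x < N'"
      using multiset_bound by metis
    \<comment> \<open>\<open>N\<close> bounds the occupied chain positions of the image, while
      \<open>N'\<close> ensures that \<open>K\<close> digits suffice to write
      \<open>count \<Lambda> y\<close>.\<close>
    define K where "K = max N N'"
    have zero: "count (glaisher m \<Lambda>) (j * m ^ k) = 0" if "K \<le> k" for k
      using that by (intro count_times_power_eq_0[OF assms(1) ji(2) N]) (simp_all add: K_def)
    have "count \<Lambda> y < K" using N'[of y] by (simp add: K_def)
    also have "\<dots> < m ^ K" using assms(1) by (simp add: power_gt_expt)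
    finally show ?thesis
      using assms(1) ji by (simp add: count_glaisher_lessThan[OF _ _ zero] digit_count_glaisher sum_digit)
  qed
qed

section \<open>Sums, and parts scaled by a factor\<close>

lemma sum_mset_eq_sum:
  fixes M :: "nat multiset"
  assumes "finite F" "set_mset M \<subseteq> F"
  shows "sum_mset M = (\<Sum>x\<in>F. count M x * x)"
  using assms(2)
proof (induction M)
  case (add y M)
  have "(\<Sum>x\<in>F. count (add_mset y M) x * x) = (\<Sum>x\<in>F. (if x = y then x else 0) + count M x * x)"
    by (rule sum.cong) auto
  with add assms(1) show ?case by (simp add: sum.distrib)
qed simp

text \<open>The digit at \<open>(k, i)\<close> contributes its multiple of
  \<open>m ^ i * (j * m ^ k)\<close>, which is symmetric in \<open>k\<close> and \<open>i\<close>,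
  so transposing changes nothing.\<close>

lemma sum_mset_glaisher:
  assumes "2 \<le> m" "0 \<notin># \<Lambda>"
  shows "sum_mset (glaisher m \<Lambda>) = sum_mset \<Lambda>"
proof -
  obtain N where N: "\<And>x. x \<in># glaisher m \<Lambda> + \<Lambda> \<Longrightarrow> x < N" "\<And>x. count (glaisher m \<Lambda> + \<Lambda>) x < N"
    using multiset_bound[of "glaisher m \<Lambda> + \<Lambda>"] by metis
  let ?J = "{j. j < N \<and> \<not> m dvd j}"
  let ?f = "\<lambda>(j, k). j * m ^ k"
  have inj: "inj_on ?f (?J \<times> {..<N})"
  proof (rule inj_onI, clarsimp)
    fix j k j' k' assume "\<not> m dvd j" "\<not> m dvd j'" and eq: "j * m ^ k = j' * m ^ k'"
    then have "k = k'" using multiplicity_times_power[OF assms(1)] by metis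
    with eq assms(1) show "j = j' \<and> k = k'" by simp
  qed
  \<comment> \<open>Stated for any \<open>M\<close>, since both \<Lambda> and its image are expanded
    over the same index ranges.\<close>
  have *: "sum_mset M = (\<Sum>j\<in>?J. \<Sum>k<N. \<Sum>i<N. digit m i (count M (j * m ^ k)) * m ^ i * (j * m ^ k))"
    if M: "\<And>x. x \<in># M \<Longrightarrow> 0 < x \<and> x < N" "\<And>x. count M x < N" for M
  proof -
    have sub: "set_mset M \<subseteq> ?f ` (?J \<times> {..<N})"
    proof
      fix x assume x: "x \<in># M"
      obtain j k where jk: "x = j * m ^ k" "\<not> m dvd j"
        using core_decomposition[OF assms(1)] M(1)[OF x] by blast
      have "j \<le> x" using jk assms(1) by simp
      then have "j < N" using M(1)[OF x] by simp
      moreover have "k < N" using M(1)[OF x] less_times_power[OF assms(1) jk(2), of k] jk(1) by simp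
      ultimately show "x \<in> ?f ` (?J \<times> {..<N})" using jk by force
    qed
    have "count M x < m ^ N" for x
      using M(2)[of x] power_gt_expt[of m N] assms(1) by linarith
    then have "(\<Sum>i<N. digit m i (count M x) * m ^ i * x) = count M x * x" for x
      by (simp add: sum_digit flip: sum_distrib_right)
    then have "(\<Sum>j\<in>?J. \<Sum>k<N. \<Sum>i<N. digit m i (count M (j * m ^ k)) * m ^ i * (j * m ^ k))
       = (\<Sum>x\<in>?f ` (?J \<times> {..<N}). count M x * x)"
      using sum.reindex[OF inj, of "\<lambda>x. count M x * x"]
      by (simp add: sum.cartesian_product case_prod_unfold o_def)
    with sum_mset_eq_sum[OF _ sub] show ?thesis by simp
  qed
  have "0 < x" if "x \<in># glaisher m \<Lambda> + \<Lambda>" for x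
    using that assms zero_notin_glaisher[OF assms(1)] by (cases "x = 0") auto
  then have pos: "\<And>x. x \<in># glaisher m \<Lambda> \<Longrightarrow> 0 < x \<and> x < N" "\<And>x. x \<in># \<Lambda> \<Longrightarrow> 0 < x \<and> x < N"
    using N(1) by simp_all
  have cnt: "\<And>x. count (glaisher m \<Lambda>) x < N" "\<And>x. count \<Lambda> x < N"
    using N(2) by (metis add_lessD1 add.commute count_union)+
  have "sum_mset (glaisher m \<Lambda>) = (\<Sum>j\<in>?J. \<Sum>k<N. \<Sum>i<N. digit m k (count \<Lambda> (j * m ^ i)) * m ^ i * (j * m ^ k))"
    using *[OF pos(1) cnt(1)] digit_count_glaisher[OF assms(1)] by simp
  also have "\<dots> = (\<Sum>j\<in>?J. \<Sum>i<N. \<Sum>k<N. digit m k (count \<Lambda> (j * m ^ i)) * m ^ i * (j * m ^ k))"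
    by (intro sum.cong refl sum.swap)
  also have "\<dots> = sum_mset \<Lambda>"
    by (simp add: *[OF pos(2) cnt(2)] mult_ac)
  finally show ?thesis .
qed


lemma glaisher_empty [simp]: "glaisher m {#} = {#}"
proof (cases "m < 2")
  case False
  then have "2 \<le> m" by simp
  have "y \<notin># glaisher m {#}" for y
    using in_glaisher_core[OF \<open>2 \<le> m\<close>, of y "{#}"] by (metis empty_iff set_mset_empty)
  then show ?thesis by (metis multiset_nonemptyE)
qed (simp add: glaisher_def)

lemma count_image_times:
  fixes k :: nat
  assumes "0 < k"
  shows "count (image_mset (\<lambda>x. x * k) M) y = (if k dvd y then count M (y div k) else 0)"
proof -
  have "{x. x \<in># M \<and> y = x * k} = (if k dvd y \<and> y div k \<in># M then {y div k} else {})"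
    using assms by auto
  then show ?thesis
    unfolding count_image_mset' by (simp add: not_in_iff)
qed

text \<open>Multiplication by \<open>k\<close> carries the chain of \<open>j'\<close> to the chain
  of \<open>k * j'\<close> with the same exponents.\<close>

lemma glaisher_image_times:
  assumes "2 \<le> m" "0 < k" "coprime k m"
  shows "glaisher m (image_mset (\<lambda>x. x * k) M) = image_mset (\<lambda>x. x * k) (glaisher m M)"
proof (rule multiset_eqI)
  fix y
  show "count (glaisher m (image_mset (\<lambda>x. x * k) M)) y = count (image_mset (\<lambda>x. x * k) (glaisher m M)) y"
  proof (cases "y = 0")
    case False
    then obtain j i where ji: "y = j * m ^ i" "\<not> m dvd j"
      using core_decomposition[OF assms(1)] by blast
    \<comment> \<open>Hence a chain consists entirely of multiples of \<open>k\<close> or contains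
      none.\<close>
    have dvd: "k dvd j * m ^ l \<longleftrightarrow> k dvd j" for l
      using assms(3) by (simp add: coprime_dvd_mult_left_iff)
    show ?thesis
    proof (cases "k dvd j")
      case True
      then obtain j' where j': "j = k * j'" by blast
      have nd: "\<not> m dvd j'" using ji(2) j' by auto
      have div: "j * m ^ l div k = j' * m ^ l" for l
        using j' assms(2) by (simp add: mult.assoc)
      have mem: "j * m ^ l \<in># image_mset (\<lambda>x. x * k) M \<longleftrightarrow> j' * m ^ l \<in># M" for l
        using True assms(2) by (simp add: count_image_times dvd div flip: count_greater_zero_iff del: set_image_mset)
      show ?thesis
        using assms ji nd True
        by (simp add: count_image_times dvd div count_glaisher mem del: set_image_mset)
    next
      case False
      then show ?thesis
        using assms ji by (simp add: count_image_times dvd count_glaisher digit_def)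
    qed
  qed (use assms in \<open>simp add: count_image_times count_glaisher_0\<close>)
qed

section \<open>Sum-preserving bijections\<close>

definition regular_distinct :: "nat \<Rightarrow> nat \<Rightarrow> nat multiset set" where
  "regular_distinct a b = {\<Lambda>. regular a \<Lambda> \<and> m_distinct b \<Lambda>}"

lemma regular_distinct_iff:
  "0 < b \<Longrightarrow> \<Lambda> \<in> regular_distinct a b \<longleftrightarrow> (\<forall>x\<in>#\<Lambda>. \<not> a dvd x) \<and> (\<forall>x. count \<Lambda> x < b)"
  by (auto simp: regular_distinct_def regular_def m_distinct_def not_in_iff)

text \<open>Every number divides 0, so regularity already forces positive parts.\<close>

lemma zero_notin_regular_distinct: "\<Lambda> \<in> regular_distinct a b \<Longrightarrow> 0 \<notin># \<Lambda>"
  unfolding regular_distinct_def regular_def by auto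

lemma regular_distinct_1_left: "0 < b \<Longrightarrow> regular_distinct 1 b = {{#}}"
  by (auto simp: regular_distinct_iff)

lemma regular_distinct_1_right: "regular_distinct a 1 = {{#}}"
  by (auto simp: regular_distinct_iff intro!: multiset_eqI)

text \<open>The sum is preserved rather than fixed because splitting distributes it over two
  components in varying ways.\<close>

definition sum_bij :: "(nat multiset \<Rightarrow> nat multiset) \<Rightarrow> nat multiset set \<Rightarrow> nat multiset set \<Rightarrow> bool" where
  "sum_bij f A B \<longleftrightarrow> bij_betw f A B \<and> (\<forall>\<Lambda>\<in>A. sum_mset (f \<Lambda>) = sum_mset \<Lambda>)"

lemma sum_bij_cong: "(\<And>\<Lambda>. \<Lambda> \<in> A \<Longrightarrow> f \<Lambda> = g \<Lambda>) \<Longrightarrow> sum_bij f A B = sum_bij g A B"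
  unfolding sum_bij_def by (simp cong: bij_betw_cong)

lemma glaisher_sum_bij:
  assumes "2 \<le> m"
  shows "sum_bij (glaisher m) (regular_distinct (m ^ e) (m ^ b)) (regular_distinct (m ^ b) (m ^ e))"
proof -
  \<comment> \<open>With \<open>e\<close> and \<open>b\<close> exchanged this also serves the
    inverse, which is the map itself.\<close>
  have maps: "glaisher m ` regular_distinct (m ^ e) (m ^ b) \<subseteq> regular_distinct (m ^ b) (m ^ e)" for e b
    using assms glaisher_not_power_dvd[OF assms]
    by (fastforce simp: regular_distinct_iff glaisher_less_power)
  show ?thesis
    unfolding sum_bij_def
    using assms
    by (intro conjI bij_betw_byWitness[where f' = "glaisher m"] maps ballI)
       (auto simp: glaisher_involution sum_mset_glaisher dest: zero_notin_regular_distinct)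
qed

lemma glaisher_regular_distinct:
  assumes "2 \<le> a" "2 \<le> b" "coprime a b" "\<Lambda> \<in> regular_distinct a b"
  shows "glaisher a (glaisher b \<Lambda>) \<in> regular_distinct b a"
proof -
  have \<Lambda>: "\<And>x. x \<in># \<Lambda> \<Longrightarrow> \<not> a dvd x" "\<And>x. count \<Lambda> x < b ^ 1"
    using assms by (auto simp: regular_distinct_iff)
  have b: "\<not> b dvd y" if "y \<in># glaisher b \<Lambda>" for y
    using glaisher_not_power_dvd[OF assms(2) \<Lambda>(2) that] by simp
  \<comment> \<open>By \<open>b\<close>-regularity of the image, \<open>y\<close> is itself the core
    of its chain, so it divides some part of \<Lambda>, and that part is not a multiple of
    \<open>a\<close>.\<close>
  have a: "\<not> a ^ 1 dvd y" if y: "y \<in># glaisher b \<Lambda>" for y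
  proof -
    obtain j i k where jik: "y = j * b ^ i" "j * b ^ k \<in># \<Lambda>"
      using in_glaisher_core[OF assms(2) y] by metis
    have "i = 0" using b[OF y] jik(1) by (cases i) auto
    with jik \<Lambda>(1)[OF jik(2)] show ?thesis by auto
  qed
  \<comment> \<open>The core of \<open>z\<close> divides a part of
    \<open>glaisher b \<Lambda>\<close>; by coprimality the power of \<open>a\<close> cannot supply
    a factor \<open>b\<close>.\<close>
  have "\<not> b dvd z" if z: "z \<in># glaisher a (glaisher b \<Lambda>)" for z
  proof -
    obtain j i k where jik: "z = j * a ^ i" "j * a ^ k \<in># glaisher b \<Lambda>"
      using in_glaisher_core[OF assms(1) z] by metis
    have "\<not> b dvd j" using b[OF jik(2)] by auto
    with assms(3) jik(1) show ?thesis
      by (simp add: coprime_dvd_mult_left_iff coprime_commute)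
  qed
  with glaisher_less_power[OF assms(1) a] assms(1) show ?thesis
    by (simp add: regular_distinct_iff)
qed

lemma glaisher_coprime_sum_bij:
  assumes "0 < a" "0 < b" "coprime a b"
  shows "sum_bij (\<lambda>\<Lambda>. glaisher a (glaisher b \<Lambda>)) (regular_distinct a b) (regular_distinct b a)"
proof (cases "a = 1 \<or> b = 1")
  \<comment> \<open>Both sets contain only the empty partition, which is fixed also under the
    convention for base 1.\<close>
  case True
  with assms(1,2) show ?thesis
    by (auto simp: sum_bij_def regular_distinct_1_left regular_distinct_1_right bij_betw_def
        simp del: One_nat_def)
next
  case False
  with assms have ab: "2 \<le> a" "2 \<le> b" by auto
  have inverse: "glaisher d (glaisher c (glaisher c (glaisher d \<Lambda>))) = \<Lambda>"
    if "2 \<le> c" "2 \<le> d" "\<Lambda> \<in> regular_distinct c d" for c d \<Lambda>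
    using that zero_notin_regular_distinct by (simp add: glaisher_involution zero_notin_glaisher)
  show ?thesis
    unfolding sum_bij_def
  proof (intro conjI bij_betw_byWitness[where f' = "\<lambda>\<Lambda>. glaisher b (glaisher a \<Lambda>)"] ballI image_subsetI)
    show "glaisher a (glaisher b \<Lambda>) \<in> regular_distinct b a" if "\<Lambda> \<in> regular_distinct a b" for \<Lambda>
      using ab assms(3) that by (rule glaisher_regular_distinct)
    show "glaisher b (glaisher a \<Lambda>) \<in> regular_distinct a b" if "\<Lambda> \<in> regular_distinct b a" for \<Lambda>
      using ab assms(3) that by (intro glaisher_regular_distinct) (simp_all add: coprime_commute)
    show "sum_mset (glaisher a (glaisher b \<Lambda>)) = sum_mset \<Lambda>" if "\<Lambda> \<in> regular_distinct a b" for \<Lambda>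
      using ab that zero_notin_regular_distinct by (simp add: sum_mset_glaisher zero_notin_glaisher)
  qed (use ab inverse in blast)+
qed

section \<open>Splitting parts and splitting frequencies\<close>

text \<open>\<open>quotient_part\<close> without the factor \<open>k\<close> on the part sizes: that
  factor belongs to the joining map of \<open>split_parts\<close> and is applied only after the
  bijection on this component.\<close>

definition quotient_freq :: "nat \<Rightarrow> nat multiset \<Rightarrow> nat multiset" where
  "quotient_freq k \<rho> = (\<Sum>x\<in>set_mset \<rho>. replicate_mset (count \<rho> x div k) x)"

lemma count_residue_part: "count (residue_part k \<rho>) x = count \<rho> x mod k"
  by (simp add: residue_part_def count_sum) (simp add: not_in_iff)

lemma count_quotient_freq: "count (quotient_freq k \<rho>) x = count \<rho> x div k"
  by (simp add: quotient_freq_def count_sum) (simp add: not_in_iff)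

lemma quotient_part_eq: "quotient_part k \<rho> = image_mset (\<lambda>x. x * k) (quotient_freq k \<rho>)"
  unfolding quotient_part_def quotient_freq_def
  by (subst sum_comp_morphism[where h = "image_mset (\<lambda>x. x * k)", symmetric]) simp_all

definition indivisible_parts :: "nat \<Rightarrow> nat multiset \<Rightarrow> nat multiset" where
  "indivisible_parts k \<Lambda> = {#x \<in># \<Lambda>. \<not> k dvd x#}"

definition divided_parts :: "nat \<Rightarrow> nat multiset \<Rightarrow> nat multiset" where
  "divided_parts k \<Lambda> = {#x div k. x \<in># {#x \<in># \<Lambda>. k dvd x#}#}"

lemma count_indivisible_parts: "count (indivisible_parts k \<Lambda>) x = (if k dvd x then 0 else count \<Lambda> x)"
  by (simp add: indivisible_parts_def)

lemma count_divided_parts: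
  assumes "0 < k"
  shows "count (divided_parts k \<Lambda>) x = count \<Lambda> (x * k)"
proof -
  have "x = y div k \<and> k dvd y \<longleftrightarrow> y = x * k" for y
    using assms by auto
  then have "{y. y \<in># {#x \<in># \<Lambda>. k dvd x#} \<and> x = y div k} = (if x * k \<in># \<Lambda> then {x * k} else {})"
    by auto
  then show ?thesis
    unfolding divided_parts_def count_image_mset' by (simp add: not_in_iff)
qed

lemma sum_mset_repeat_mset: "sum_mset (repeat_mset k M) = k * sum_mset M" for M :: "nat multiset"
  by (induction k) simp_all

lemma sum_mset_image_times: "sum_mset (image_mset (\<lambda>x. x * k) M) = k * sum_mset M" for k :: nat
  by (induction M) (simp_all add: algebra_simps)

lemma frequency_decomposition: "residue_part k \<Lambda> + repeat_mset k (quotient_freq k \<Lambda>) = \<Lambda>"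
  by (rule multiset_eqI) (simp add: count_residue_part count_quotient_freq)

lemma part_decomposition:
  "0 < k \<Longrightarrow> indivisible_parts k \<Lambda> + image_mset (\<lambda>x. x * k) (divided_parts k \<Lambda>) = \<Lambda>"
  by (rule multiset_eqI) (simp add: count_indivisible_parts count_divided_parts count_image_times)

text \<open>Division of each frequency by \<open>k\<close> with remainder: the quotient is below
  \<open>q\<close> exactly when the frequency is below \<open>k * q\<close>.\<close>

lemma split_frequencies:
  assumes "0 < k" "0 < q"
  shows "bij_betw (\<lambda>\<Lambda>. (residue_part k \<Lambda>, quotient_freq k \<Lambda>))
           (regular_distinct a (k * q)) (regular_distinct a k \<times> regular_distinct a q)" (is ?split)
    and "bij_betw (\<lambda>(A, B). A + repeat_mset k B)
           (regular_distinct a k \<times> regular_distinct a q) (regular_distinct a (k * q))" (is ?join)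
proof -
  let ?f = "\<lambda>\<Lambda>. (residue_part k \<Lambda>, quotient_freq k \<Lambda>)" and ?g = "\<lambda>(A, B). A + repeat_mset k B"
  let ?X = "regular_distinct a (k * q)" and ?Y = "regular_distinct a k \<times> regular_distinct a q"
  have "\<forall>\<Lambda>\<in>?X. ?g (?f \<Lambda>) = \<Lambda>"
    by (simp add: frequency_decomposition)
  moreover have "\<forall>P\<in>?Y. ?f (?g P) = P"
    using assms by (auto simp: regular_distinct_iff multiset_eq_iff count_residue_part count_quotient_freq)
  moreover have "?f ` ?X \<subseteq> ?Y"
  proof clarify
    fix \<Lambda> assume \<Lambda>: "\<Lambda> \<in> ?X"
    have "x \<in># \<Lambda>" if "x \<in># residue_part k \<Lambda> \<or> x \<in># quotient_freq k \<Lambda>" for x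
      using that frequency_decomposition[of k \<Lambda>] assms
      by (metis count_quotient_freq count_residue_part div_0 mod_0 not_in_iff)
    with \<Lambda> assms show "residue_part k \<Lambda> \<in> regular_distinct a k \<and> quotient_freq k \<Lambda> \<in> regular_distinct a q"
      by (auto simp: regular_distinct_iff count_residue_part count_quotient_freq less_mult_imp_div_less mult.commute)
  qed
  moreover have "?g ` ?Y \<subseteq> ?X"
  proof clarify
    fix A B assume AB: "A \<in> regular_distinct a k" "B \<in> regular_distinct a q"
    have "count A x + k * count B x < k * q" for x
    proof -
      have "count A x + k * count B x < k * Suc (count B x)"
        using AB assms by (simp add: regular_distinct_iff)
      also have "\<dots> \<le> k * q" using AB assms by (intro mult_le_mono2) (simp add: regular_distinct_iff Suc_le_eq)
      finally show ?thesis .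
    qed
    moreover have "x \<in># A \<or> x \<in># B" if "x \<in># A + repeat_mset k B" for x
      using that by (auto simp flip: count_greater_zero_iff)
    ultimately show "A + repeat_mset k B \<in> ?X"
      using AB assms unfolding regular_distinct_iff[OF assms(1)] regular_distinct_iff[OF assms(2)]
      by (subst regular_distinct_iff) (simp, metis count_repeat_mset count_union)
  qed
  ultimately show ?split ?join
    by (auto intro!: bij_betw_byWitness[where f = ?f and f' = ?g] bij_betw_byWitness[where f = ?g and f' = ?f])
qed

text \<open>A multiple \<open>x * k\<close> of \<open>k\<close> avoids \<open>k * q\<close> exactly
  when \<open>x\<close> avoids \<open>q\<close>.\<close>

lemma split_parts:
  assumes "0 < k" "0 < b"
  shows "bij_betw (\<lambda>\<Lambda>. (indivisible_parts k \<Lambda>, divided_parts k \<Lambda>))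
           (regular_distinct (k * q) b) (regular_distinct k b \<times> regular_distinct q b)" (is ?split)
    and "bij_betw (\<lambda>(A, B). A + image_mset (\<lambda>x. x * k) B)
           (regular_distinct k b \<times> regular_distinct q b) (regular_distinct (k * q) b)" (is ?join)
proof -
  let ?f = "\<lambda>\<Lambda>. (indivisible_parts k \<Lambda>, divided_parts k \<Lambda>)" and ?g = "\<lambda>(A, B). A + image_mset (\<lambda>x. x * k) B"
  let ?X = "regular_distinct (k * q) b" and ?Y = "regular_distinct k b \<times> regular_distinct q b"
  have "\<forall>\<Lambda>\<in>?X. ?g (?f \<Lambda>) = \<Lambda>"
    using assms by (simp add: part_decomposition)
  moreover have "\<forall>P\<in>?Y. ?f (?g P) = P"
    using assms
    by (auto simp: regular_distinct_iff multiset_eq_iff count_indivisible_parts count_divided_parts count_image_times)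
       (metis dvd_triv_right not_in_iff)+
  moreover have "?f ` ?X \<subseteq> ?Y"
  proof clarify
    fix \<Lambda> assume \<Lambda>: "\<Lambda> \<in> ?X"
    have "x * k \<in># \<Lambda>" if "x \<in># divided_parts k \<Lambda>" for x
      using that assms(1) by (simp add: count_divided_parts flip: count_greater_zero_iff)
    moreover have "\<not> k * q dvd x * k \<longleftrightarrow> \<not> q dvd x" for x
      using assms(1) by (simp add: mult.commute[of k])
    ultimately have "\<not> q dvd x" if "x \<in># divided_parts k \<Lambda>" for x
      using that \<Lambda> assms(2) by (metis regular_distinct_iff)
    with \<Lambda> assms show "indivisible_parts k \<Lambda> \<in> regular_distinct k b \<and> divided_parts k \<Lambda> \<in> regular_distinct q b"
      by (auto simp: regular_distinct_iff count_indivisible_parts count_divided_parts)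
         (simp add: indivisible_parts_def)
  qed
  moreover have "?g ` ?Y \<subseteq> ?X"
  proof clarify
    fix A B assume AB: "A \<in> regular_distinct k b" "B \<in> regular_distinct q b"
    \<comment> \<open>The two summands share no part size, so no frequencies add up and the bound
      \<open>b\<close> is kept.\<close>
    have "count A x = 0" if "k dvd x" for x
      using AB(1) that assms(2) by (metis not_in_iff regular_distinct_iff)
    then show "A + image_mset (\<lambda>x. x * k) B \<in> ?X"
      using AB assms
      by (auto simp: regular_distinct_iff count_image_times mult.commute[of k] dest: dvd_mult_right)
  qed
  ultimately show ?split ?join
    by (auto intro!: bij_betw_byWitness[where f = ?f and f' = ?g] bij_betw_byWitness[where f = ?g and f' = ?f])
qed

text \<open>The sum is preserved because the second component counts \<open>k\<close> times in it,
  both as repeated parts before and as scaled parts after.\<close>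

lemma combine_over_frequencies:
  assumes "0 < k" "0 < q" "0 < a"
    and f: "sum_bij f (regular_distinct a k) (regular_distinct k a)"
    and g: "sum_bij g (regular_distinct a q) (regular_distinct q a)"
  shows "sum_bij (\<lambda>\<Lambda>. f (residue_part k \<Lambda>) + image_mset (\<lambda>x. x * k) (g (quotient_freq k \<Lambda>)))
           (regular_distinct a (k * q)) (regular_distinct (k * q) a)"
proof -
  note split = split_frequencies(1)[OF assms(1,2), of a]
  have "sum_mset (f (residue_part k \<Lambda>) + image_mset (\<lambda>x. x * k) (g (quotient_freq k \<Lambda>))) = sum_mset \<Lambda>"
    if "\<Lambda> \<in> regular_distinct a (k * q)" for \<Lambda>
    using bij_betw_apply[OF split that] f g arg_cong[OF frequency_decomposition[of k \<Lambda>], of sum_mset]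
    by (simp add: sum_bij_def sum_mset_image_times sum_mset_repeat_mset)
  moreover have "bij_betw (map_prod f g) (regular_distinct a k \<times> regular_distinct a q)
      (regular_distinct k a \<times> regular_distinct q a)"
    using f g by (intro bij_betw_map_prod) (simp_all add: sum_bij_def)
  from bij_betw_trans[OF bij_betw_trans[OF split this] split_parts(2)[OF assms(1,3)]]
  have "bij_betw (\<lambda>\<Lambda>. f (residue_part k \<Lambda>) + image_mset (\<lambda>x. x * k) (g (quotient_freq k \<Lambda>)))
      (regular_distinct a (k * q)) (regular_distinct (k * q) a)"
    by (simp add: o_def)
  ultimately show ?thesis by (simp add: sum_bij_def)
qed

lemma combine_over_parts:
  assumes "0 < k" "0 < q" "0 < b"
    and f: "sum_bij f (regular_distinct k b) (regular_distinct b k)"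
    and g: "sum_bij g (regular_distinct q b) (regular_distinct b q)"
  shows "sum_bij (\<lambda>\<Lambda>. f (indivisible_parts k \<Lambda>) + repeat_mset k (g (divided_parts k \<Lambda>)))
           (regular_distinct (k * q) b) (regular_distinct b (k * q))"
proof -
  note split = split_parts(1)[OF assms(1,3), of q]
  have "sum_mset (f (indivisible_parts k \<Lambda>) + repeat_mset k (g (divided_parts k \<Lambda>))) = sum_mset \<Lambda>"
    if "\<Lambda> \<in> regular_distinct (k * q) b" for \<Lambda>
    using bij_betw_apply[OF split that] f g arg_cong[OF part_decomposition[OF assms(1), of \<Lambda>], of sum_mset]
    by (simp add: sum_bij_def sum_mset_image_times sum_mset_repeat_mset)
  moreover have "bij_betw (map_prod f g) (regular_distinct k b \<times> regular_distinct q b)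
      (regular_distinct b k \<times> regular_distinct b q)"
    using f g by (intro bij_betw_map_prod) (simp_all add: sum_bij_def)
  from bij_betw_trans[OF bij_betw_trans[OF split this] split_frequencies(2)[OF assms(1,2)]]
  have "bij_betw (\<lambda>\<Lambda>. f (indivisible_parts k \<Lambda>) + repeat_mset k (g (divided_parts k \<Lambda>)))
      (regular_distinct (k * q) b) (regular_distinct b (k * q))"
    by (simp add: o_def)
  ultimately show ?thesis by (simp add: sum_bij_def)
qed

section \<open>The stages\<close>

text \<open>The passage from \<rho> to \<nu> within a stage, freed from the weight.\<close>

definition prime_stage :: "nat \<Rightarrow> nat \<Rightarrow> nat \<Rightarrow> nat multiset \<Rightarrow> nat multiset" where
  "prime_stage p e k \<rho> = glaisher (p ^ e) (glaisher k (residue_part k \<rho>)) + glaisher p (quotient_part k \<rho>)"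

text \<open>\<open>combine_over_frequencies\<close> scales parts after applying
  \<open>glaisher p\<close>, \<open>prime_stage\<close> before; \<open>glaisher_image_times\<close>
  reconciles the two.\<close>

lemma prime_stage_sum_bij:
  assumes "prime p" "0 < k" "coprime k p"
  shows "sum_bij (prime_stage p e k) (regular_distinct (p ^ e) (k * p ^ b)) (regular_distinct (k * p ^ b) (p ^ e))"
proof -
  have p: "2 \<le> p" "0 < p ^ n" for n
    using assms(1) by (simp_all add: prime_ge_2_nat prime_gt_0_nat)
  have "sum_bij (\<lambda>\<rho>. glaisher (p ^ e) (glaisher k (residue_part k \<rho>))
            + image_mset (\<lambda>x. x * k) (glaisher p (quotient_freq k \<rho>)))
          (regular_distinct (p ^ e) (k * p ^ b)) (regular_distinct (k * p ^ b) (p ^ e))"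
    using assms p
    by (intro combine_over_frequencies glaisher_coprime_sum_bij glaisher_sum_bij) (simp_all add: coprime_commute)
  then show ?thesis
    using p assms by (simp add: prime_stage_def[abs_def] quotient_part_eq glaisher_image_times)
qed

text \<open>The next weight is the current one times \<open>p ^ e\<close>, so the upper filter of a
  stage is the one for the next weight.\<close>

lemma stage_eq:
  "stage s t ps i \<Lambda> =
    repeat_mset (weight s t ps i)
      (prime_stage (ps ! i) (multiplicity (ps ! i) s) (t div (ps ! i) ^ multiplicity (ps ! i) t)
        (divided_parts (weight s t ps i) (indivisible_parts (weight s t ps (Suc i)) \<Lambda>)))"
  by (simp add: stage_def Let_def prime_stage_def divided_parts_def indivisible_parts_def weight_def
      filter_filter_mset mult.assoc conj_commute)

lemma stage0_eq:
  "stage0 s t \<Lambda> = glaisher (coprime_part s t) (glaisher t (indivisible_parts (coprime_part s t) \<Lambda>))"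
  by (simp add: stage0_def Let_def indivisible_parts_def)

text \<open>Weights form a divisibility chain, so by this earlier stages do not notice the removal
  of the multiples of a later weight.\<close>

lemma indivisible_parts_idem: "j dvd k \<Longrightarrow> indivisible_parts j (indivisible_parts k \<Lambda>) = indivisible_parts j \<Lambda>"
  by (auto simp: multiset_eq_iff count_indivisible_parts dest: dvd_trans)

lemma indivisible_parts_regular: "\<Lambda> \<in> regular_distinct k b \<Longrightarrow> indivisible_parts k \<Lambda> = \<Lambda>"
  by (auto simp: regular_distinct_def regular_def indivisible_parts_def filter_mset_eq_conv)

lemma weight_dvd: "i \<le> j \<Longrightarrow> weight s t ps i dvd weight s t ps j"
  unfolding weight_def by (intro mult_dvd_mono prod_dvd_prod_subset) auto

lemma coprime_coprime_part: "coprime (coprime_part s t) t"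
  unfolding coprime_part_def by (intro prod_coprime_left) (auto simp: prime_imp_coprime coprime_power_left_iff)

lemma coprime_part_pos: "0 < coprime_part s t"
  unfolding coprime_part_def by (intro prod_pos) (simp add: prime_gt_0_nat)

text \<open>Induction on the number of stages: \<open>combine_over_parts\<close> with
  \<open>k\<close> the current weight joins the earlier stages to the next one.\<close>

lemma partial_Psi_sum_bij:
  assumes "0 < t" "\<And>p. p \<in> set ps \<Longrightarrow> prime p" "r \<le> length ps"
  shows "sum_bij (\<lambda>\<Lambda>. stage0 s t \<Lambda> + (\<Sum>i<r. stage s t ps i \<Lambda>))
           (regular_distinct (weight s t ps r) t) (regular_distinct t (weight s t ps r))"
  using assms(3)
proof (induction r)
  case 0
  have "sum_bij (\<lambda>\<Lambda>. glaisher (coprime_part s t) (glaisher t \<Lambda>))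
      (regular_distinct (coprime_part s t) t) (regular_distinct t (coprime_part s t))"
    using assms(1) by (intro glaisher_coprime_sum_bij coprime_part_pos coprime_coprime_part)
  also have "?this \<longleftrightarrow> sum_bij (stage0 s t) (regular_distinct (coprime_part s t) t) (regular_distinct t (coprime_part s t))"
    by (rule sum_bij_cong) (simp add: stage0_eq indivisible_parts_regular)
  finally show ?case by (simp add: weight_def)
next
  case (Suc r)
  define W where "W = weight s t ps r"
  define p where "p = ps ! r"
  define e where "e = multiplicity p s"
  define k where "k = t div p ^ multiplicity p t"
  let ?P = "\<lambda>r \<Lambda>. stage0 s t \<Lambda> + (\<Sum>i<r. stage s t ps i \<Lambda>)"
  have W_Suc: "weight s t ps (Suc r) = W * p ^ e"
    by (simp add: weight_def W_def p_def e_def)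
  have p: "prime p" using Suc.prems assms(2) by (simp add: p_def)
  have pos: "0 < weight s t ps i" if "i \<le> length ps" for i
    unfolding weight_def using that assms(2) coprime_part_pos
    by (auto intro!: prod_pos simp: prime_gt_0_nat)
  have t: "t = k * p ^ multiplicity p t"
    by (simp add: k_def multiplicity_dvd)
  have "\<not> p dvd k"
    using assms(1) p unfolding k_def by (intro multiplicity_decompose) auto
  with p have "coprime k p" using prime_imp_coprime coprime_commute by blast
  moreover have "0 < k" using t assms(1) by (metis gr0I mult_0)
  ultimately have "sum_bij (prime_stage p e k) (regular_distinct (p ^ e) t) (regular_distinct t (p ^ e))"
    using prime_stage_sum_bij[OF p, of k e "multiplicity p t"] t by simp
  moreover have "sum_bij (?P r) (regular_distinct W t) (regular_distinct t W)"
    using Suc by (simp add: W_def)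
  ultimately have "sum_bij (\<lambda>\<Lambda>. ?P r (indivisible_parts W \<Lambda>) + repeat_mset W (prime_stage p e k (divided_parts W \<Lambda>)))
      (regular_distinct (W * p ^ e) t) (regular_distinct t (W * p ^ e))"
    using p assms(1) pos[of r] Suc.prems by (intro combine_over_parts) (simp_all add: W_def prime_gt_0_nat)
  moreover have "?P r (indivisible_parts W \<Lambda>) + repeat_mset W (prime_stage p e k (divided_parts W \<Lambda>)) = ?P (Suc r) \<Lambda>"
    if \<Lambda>: "\<Lambda> \<in> regular_distinct (W * p ^ e) t" for \<Lambda>
  proof -
    have "coprime_part s t dvd W" by (simp add: W_def weight_def)
    then have "stage0 s t (indivisible_parts W \<Lambda>) = stage0 s t \<Lambda>"
      by (simp add: stage0_eq indivisible_parts_idem)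
    moreover have "stage s t ps i (indivisible_parts W \<Lambda>) = stage s t ps i \<Lambda>" if "i < r" for i
      using that by (simp add: stage_eq indivisible_parts_idem W_def weight_dvd)
    \<comment> \<open>Since \<Lambda> is regular for the next weight, the upper filter of this stage
      removes nothing.\<close>
    moreover have "repeat_mset W (prime_stage p e k (divided_parts W \<Lambda>)) = stage s t ps r \<Lambda>"
      using indivisible_parts_regular[OF \<Lambda>]
      by (simp add: stage_eq W_Suc flip: p_def W_def e_def k_def)
    ultimately show ?thesis by (simp add: add.assoc)
  qed
  ultimately show ?case
    unfolding W_Suc by (subst (asm) sum_bij_cong)
qed

text \<open>Unique factorization of \<open>s\<close>, its primes being sorted by whether they divide
  \<open>t\<close>.\<close>

lemma weight_length:
  assumes "0 < s" "distinct ps" "set ps = {p. prime p \<and> p dvd s \<and> p dvd t}"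
  shows "weight s t ps (length ps) = s"
proof -
  let ?f = "\<lambda>p. p ^ multiplicity p s" and ?C = "{p. prime p \<and> p dvd s \<and> \<not> p dvd t}"
  have eq: "prime_factors s = ?C \<union> set ps"
    using assms by (auto simp: prime_factors_dvd)
  have "(\<Prod>j<length ps. ?f (ps ! j)) = prod ?f (set ps)"
    by (rule prod.reindex_bij_betw) (simp add: bij_betw_nth assms(2))
  moreover have "prod ?f (?C \<union> set ps) = prod ?f ?C * prod ?f (set ps)"
    using eq by (intro prod.union_disjoint) (auto simp: assms(3) intro: finite_subset[OF _ finite_set_mset])
  ultimately show ?thesis
    using prime_factorization_nat[OF assms(1)] eq by (simp add: weight_def coprime_part_def)
qed

theorem mainTheorem1:
  fixes s t n :: nat and ps :: "nat list"
  assumes "0 < s" and "0 < t"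
    and "distinct ps" and "set ps = {p. prime p \<and> p dvd s \<and> p dvd t}"
  shows "bij_betw (Psi s t ps)
           {\<Lambda>. partition_of n \<Lambda> \<and> regular s \<Lambda> \<and> m_distinct t \<Lambda>}
           {\<Lambda>. partition_of n \<Lambda> \<and> regular t \<Lambda> \<and> m_distinct s \<Lambda>}"
proof -
  \<comment> \<open>The sets of the theorem are level sets of the sum, to which a sum-preserving
    bijection restricts.\<close>
  have eq: "{\<Lambda>. partition_of n \<Lambda> \<and> regular a \<Lambda> \<and> m_distinct b \<Lambda>} = {\<Lambda> \<in> regular_distinct a b. sum_mset \<Lambda> = n}" for a b
    by (auto simp: regular_distinct_def partition_of_def regular_def intro!: gr0I)
  have "sum_bij (Psi s t ps) (regular_distinct s t) (regular_distinct t s)"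
    using partial_Psi_sum_bij[of t ps "length ps" s] assms weight_length[OF assms(1,3,4)]
    by (simp add: Psi_def[abs_def])
  then show ?thesis
    unfolding eq sum_bij_def by (auto intro: bij_betw_Collect)
qed

end
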